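(* There is an efficient algorithm for threshold testing with a continuous distribution that is $(0.869-o(1))$-competitive. That is, there is an efficient testing algorithm (defined for every number $n$ of boxes) and a function $\varepsilon(n)\to 0$ as $n\to\infty$ such that for every continuous distribution $F$ on $\mathbb{R}_{\ge 0}$ with finite expectation and every $n$, if $X_1,\dots,X_n$ are i.i.d.\ with distribution $F$ and $\sigma$ is the box chosen by the algorithm, then $\mathbb{E}[X_\sigma]\ge (0.869-\varepsilon(n))\cdot \mathbb{E}[\max\{X_1,\dots,X_n\}]$.
   Context: Threshold testing: A distribution $F$ on $\mathbb{R}_{\ge0}$ with finite expectation is known. There are $n$ boxes; box $i$ contains a hidden value $X_i$, where $X_1,\dots,X_n$ are drawn once upfront i.i.d.\ from $F$. A testing algorithm tests each box exactly once, in the order $1,2,\dots,n$: to test box $i$ it chooses a threshold $t_i\ge 0$ and learns only whether $X_i\ge t_i$ (positive test) or $X_i<t_i$ (negative test). Thresholds may be chosen adaptively, i.e., depending on the outcomes of earlier tests (and internal randomness). After all $n$ tests, the algorithm chooses a box $\sigma\in\{1,\dots,n\}$ based on the observed feedback and receives $X_\sigma$. An algorithm is $c$-competitive if $\mathbb{E}[X_\sigma]\ge c\cdot\mathbb{E}[\max\{X_1,\dots,X_n\}]$. *)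

theory Defs
  imports "HOL-Probability.Probability"
begin

section \<open>Distributions\<close>

definition continuous_nonneg_distribution :: "real measure \<Rightarrow> bool" where
  "continuous_nonneg_distribution F \<longleftrightarrow>
     real_distribution F \<and> (AE x in F. 0 \<le> x) \<and> integrable F (\<lambda>x. x) \<and>
     continuous_on UNIV (cdf F)"

text \<open>The branch for \<open>p \<ge> 1\<close> only avoids the unspecified infimum of a possibly empty set.\<close>

definition quantile :: "real measure \<Rightarrow> real \<Rightarrow> real" where
  "quantile F p = (if p < 1 then Inf {x. 0 \<le> x \<and> p \<le> cdf F x} else 0)"

definition tail_expectation :: "real measure \<Rightarrow> real \<Rightarrow> real" where
  "tail_expectation F t = (LINT x|F. x * indicator {t..} x)"


section \<open>Testing programs\<close>

text \<open>
  Algorithms are programs for a real RAM: a memory of natural numbers and a memory of reals, both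
  with indirect addressing. The distribution is an infinite object; a program accesses it through
  oracles for its distribution function, its quantiles and its tail expectations. The hidden values
  are accessed only through \<open>Test\<close>.

  One execution step counts as one unit of time. Expressions have a size fixed by the program, so
  charging a unit for the evaluation of a whole expression changes running times by a constant
  factor only. Natural numbers admit no multiplication, so that in polynomial time they only reach
  polynomially many bits; reals have exact arithmetic and comparisons (but no rounding) at unit
  cost. The only constants are rational, so no information can be encoded in a real constant.
\<close>

datatype nexp =
    NConst nat
  | NLoad nexp
  | NPlus nexp nexp
  | NMinus nexp nexp

datatype rexp =
    RConst rat
  | RLoad nexp
  | OfNat nexp
  | RPlus rexp rexp
  | RMinus rexp rexp
  | RTimes rexp rexp
  | RDivide rexp rexp
  | Cdf rexp
  | Quantile rexp
  | Tail rexp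

datatype bexp =
    NLess nexp nexp
  | RLess rexp rexp
  | BNot bexp
  | BAnd bexp bexp

text \<open>
  \<open>NStore a e\<close> and \<open>RStore a e\<close> write the value of \<open>e\<close> to address \<open>a\<close>, \<open>Draw a\<close> writes a fresh
  random number from \<open>[0,1]\<close> to the real address \<open>a\<close>, and \<open>Test a t\<close> tests the next untested box
  with threshold \<open>t\<close> and writes \<open>1\<close> (positive) or \<open>0\<close> (negative) to the natural address \<open>a\<close>.
\<close>

datatype prog =
    Skip
  | NStore nexp nexp
  | RStore nexp rexp
  | Draw nexp
  | Test nexp rexp
  | Sequence prog prog
  | Cond bexp prog prog
  | While bexp prog

record state =
  nmem :: "nat \<Rightarrow> nat"
  rmem :: "nat \<Rightarrow> real"
  draws :: nat
  thresholds :: "real list"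

primrec nval :: "nexp \<Rightarrow> state \<Rightarrow> nat" where
  "nval (NConst k) s = k"
| "nval (NLoad a) s = nmem s (nval a s)"
| "nval (NPlus e f) s = nval e s + nval f s"
| "nval (NMinus e f) s = nval e s - nval f s"

primrec rval :: "real measure \<Rightarrow> rexp \<Rightarrow> state \<Rightarrow> real" where
  "rval F (RConst q) s = of_rat q"
| "rval F (RLoad a) s = rmem s (nval a s)"
| "rval F (OfNat e) s = real (nval e s)"
| "rval F (RPlus e f) s = rval F e s + rval F f s"
| "rval F (RMinus e f) s = rval F e s - rval F f s"
| "rval F (RTimes e f) s = rval F e s * rval F f s"
| "rval F (RDivide e f) s = rval F e s / rval F f s"
| "rval F (Cdf e) s = cdf F (rval F e s)"
| "rval F (Quantile e) s = quantile F (rval F e s)"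
| "rval F (Tail e) s = tail_expectation F (rval F e s)"

primrec bval :: "real measure \<Rightarrow> bexp \<Rightarrow> state \<Rightarrow> bool" where
  "bval F (NLess e f) s \<longleftrightarrow> nval e s < nval f s"
| "bval F (RLess e f) s \<longleftrightarrow> rval F e s < rval F f s"
| "bval F (BNot b) s \<longleftrightarrow> \<not> bval F b s"
| "bval F (BAnd b c) s \<longleftrightarrow> bval F b s \<and> bval F c s"

text \<open>
  Small-step semantics for hidden values \<open>x 1, x 2, \<dots>\<close> and random numbers \<open>u 0, u 1, \<dots>\<close>. The tests
  done so far are those of the boxes \<open>1, \<dots>, length (thresholds s)\<close>. A program has halted when
  \<open>Skip\<close> is left, which is a fixed point.
\<close>

primrec step ::
  "real measure \<Rightarrow> (nat \<Rightarrow> real) \<Rightarrow> (nat \<Rightarrow> real) \<Rightarrow> prog \<Rightarrow> state \<Rightarrow> prog \<times> state" where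
  "step F x u Skip s = (Skip, s)"
| "step F x u (NStore a e) s = (Skip, s\<lparr>nmem := (nmem s)(nval a s := nval e s)\<rparr>)"
| "step F x u (RStore a e) s = (Skip, s\<lparr>rmem := (rmem s)(nval a s := rval F e s)\<rparr>)"
| "step F x u (Draw a) s =
     (Skip, s\<lparr>rmem := (rmem s)(nval a s := u (draws s)), draws := Suc (draws s)\<rparr>)"
| "step F x u (Test a e) s =
     (let t = rval F e s; i = Suc (length (thresholds s))
      in (Skip, s\<lparr>nmem := (nmem s)(nval a s := (if t \<le> x i then 1 else 0)),
                  thresholds := thresholds s @ [t]\<rparr>))"
| "step F x u (Sequence P Q) s =
     (if P = Skip then (Q, s)
      else let (P', s') = step F x u P s in (Sequence P' Q, s'))"
| "step F x u (Cond b P Q) s = ((if bval F b s then P else Q), s)"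
| "step F x u (While b P) s =
     ((if bval F b s then Sequence P (While b P) else Skip), s)"

text \<open>The input is the number of boxes, at natural address 0.\<close>

definition init :: "nat \<Rightarrow> state" where
  "init n = \<lparr>nmem = (\<lambda>_. 0)(0 := n), rmem = (\<lambda>_. 0), draws = 0, thresholds = []\<rparr>"

definition run ::
  "prog \<Rightarrow> real measure \<Rightarrow> nat \<Rightarrow> (nat \<Rightarrow> real) \<Rightarrow> (nat \<Rightarrow> real) \<Rightarrow> nat \<Rightarrow> prog \<times> state" where
  "run P F n x u k = ((\<lambda>(Q, s). step F x u Q s) ^^ k) (P, init n)"

definition halts ::
  "prog \<Rightarrow> real measure \<Rightarrow> nat \<Rightarrow> (nat \<Rightarrow> real) \<Rightarrow> (nat \<Rightarrow> real) \<Rightarrow> bool" where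
  "halts P F n x u \<longleftrightarrow> (\<exists>k. fst (run P F n x u k) = Skip)"

definition run_time ::
  "prog \<Rightarrow> real measure \<Rightarrow> nat \<Rightarrow> (nat \<Rightarrow> real) \<Rightarrow> (nat \<Rightarrow> real) \<Rightarrow> nat" where
  "run_time P F n x u = (LEAST k. fst (run P F n x u k) = Skip)"

definition final_state ::
  "prog \<Rightarrow> real measure \<Rightarrow> nat \<Rightarrow> (nat \<Rightarrow> real) \<Rightarrow> (nat \<Rightarrow> real) \<Rightarrow> state" where
  "final_state P F n x u = snd (run P F n x u (run_time P F n x u))"

text \<open>The output is the chosen box, at natural address 0.\<close>

definition chosen_box ::
  "prog \<Rightarrow> real measure \<Rightarrow> nat \<Rightarrow> (nat \<Rightarrow> real) \<Rightarrow> (nat \<Rightarrow> real) \<Rightarrow> nat" where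
  "chosen_box P F n x u = nmem (final_state P F n x u) 0"

definition admissible ::
  "real measure \<Rightarrow> nat \<Rightarrow> (nat \<Rightarrow> real) \<Rightarrow> (nat \<Rightarrow> real) \<Rightarrow> bool" where
  "admissible F n x u \<longleftrightarrow>
     continuous_nonneg_distribution F \<and> 1 \<le> n \<and> (\<forall>i\<in>{1..n}. 0 \<le> x i) \<and> (\<forall>j. u j \<in> {0..1})"

text \<open>
  \<open>Test\<close> proceeds through the boxes in order, so performing exactly \<open>n\<close> tests means testing each of
  the boxes \<open>1, \<dots>, n\<close> exactly once, in this order.
\<close>

definition testing_algorithm :: "prog \<Rightarrow> bool" where
  "testing_algorithm P \<longleftrightarrow>
     (\<forall>F n x u. admissible F n x u \<longrightarrow>
        halts P F n x u \<and>
        length (thresholds (final_state P F n x u)) = n \<and>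
        (\<forall>t\<in>set (thresholds (final_state P F n x u)). 0 \<le> t) \<and>
        chosen_box P F n x u \<in> {1..n})"

definition efficient :: "prog \<Rightarrow> bool" where
  "efficient P \<longleftrightarrow>
     (\<exists>C d :: nat. \<forall>F n x u. admissible F n x u \<longrightarrow>
        halts P F n x u \<and> run_time P F n x u \<le> C * n ^ d)"


section \<open>Expected values\<close>

definition values_measure :: "real measure \<Rightarrow> nat \<Rightarrow> (nat \<Rightarrow> real) measure" where
  "values_measure F n = (\<Pi>\<^sub>M i\<in>{1..n}. F)"

definition randomness_measure :: "(nat \<Rightarrow> real) measure" where
  "randomness_measure = (\<Pi>\<^sub>M j\<in>UNIV. uniform_measure lborel {0..1})"

definition expected_reward :: "prog \<Rightarrow> real measure \<Rightarrow> nat \<Rightarrow> real" where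
  "expected_reward P F n =
     (LINT (x, u)|(values_measure F n \<Otimes>\<^sub>M randomness_measure). x (chosen_box P F n x u))"

definition expected_maximum :: "real measure \<Rightarrow> nat \<Rightarrow> real" where
  "expected_maximum F n = (LINT x|values_measure F n. Max (x ` {1..n}))"

end

theory Submission
  imports Defs
begin

text \<open>
  The program keeps a level, initially \<open>0\<close>, and a candidate. At level \<open>l < 3\<close> it tests with the
  threshold exceeded with probability \<open>\<theta>\<^sub>l / n\<close>, where \<open>\<theta> = (2.035, 0.506, 0.057)\<close>; a positive test makes
  the box the candidate and raises the level. Let \<open>p = P(X \<ge> t)\<close>. Given that the last accepted test
  was at level \<open>l\<close>, the chosen value is at least \<open>t\<close> with probability \<open>min 1 (p n / \<theta>\<^sub>l)\<close>, whereas the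
  maximum is at least \<open>t\<close> with probability \<open>1 - (1 - p) ^ n\<close>. The probabilities of the final levels
  are divided differences of the powers \<open>(1 - \<theta>\<^sub>l / n) ^ n\<close>, hence converge to combinations of
  \<open>exp (- \<theta>\<^sub>l)\<close>, and with these limits the former tail exceeds \<open>0.869\<close> times the latter for all \<open>p\<close> with
  a margin. So the tail inequality holds for all large \<open>n\<close>, uniformly in \<open>F\<close>, and integrating it over
  \<open>t\<close> gives the ratio with error \<open>0\<close> for these \<open>n\<close>.
\<close>

section \<open>Execution of programs\<close>

text \<open>The second conjunct makes \<open>k\<close> the exact halting time: \<open>Skip\<close>
  is a fixed point, so the first one alone would also hold for every later \<open>k\<close>.\<close>

definition exec ::
  "real measure \<Rightarrow> (nat \<Rightarrow> real) \<Rightarrow> (nat \<Rightarrow> real) \<Rightarrow> prog \<Rightarrow> state \<Rightarrow> nat \<Rightarrow> state \<Rightarrow> bool" where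
  "exec F x u P s k s' \<longleftrightarrow>
     ((\<lambda>(Q, s). step F x u Q s) ^^ k) (P, s) = (Skip, s') \<and>
     (\<forall>j<k. fst (((\<lambda>(Q, s). step F x u Q s) ^^ j) (P, s)) \<noteq> Skip)"

lemma exec_0_iff: "exec F x u P s 0 s' \<longleftrightarrow> P = Skip \<and> s' = s"
  by (auto simp: exec_def)

text \<open>Peels off the first step; with \<open>exec_0_iff\<close> it lets the simplifier run
  loop-free programs symbolically.\<close>

lemma exec_Suc_iff:
  "exec F x u P s (Suc k) s' \<longleftrightarrow>
     P \<noteq> Skip \<and> exec F x u (fst (step F x u P s)) (snd (step F x u P s)) k s'"
  unfolding exec_def All_less_Suc2 funpow_Suc_right
  by (auto simp: case_prod_beta)

text \<open>The additional step drops the finished \<open>Skip\<close> in front of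
  \<open>Q\<close>.\<close>

lemma exec_Sequence:
  assumes "exec F x u P s k s1" "exec F x u Q s1 m s2"
  shows "exec F x u (Sequence P Q) s (Suc (k + m)) s2"
  using assms(1)
proof (induction k arbitrary: P s)
  case 0
  then show ?case using assms(2) by (simp add: exec_0_iff exec_Suc_iff)
next
  case (Suc k)
  then show ?case by (simp add: exec_Suc_iff[of _ _ _ P] exec_Suc_iff[of _ _ _ "Sequence _ _"] case_prod_beta)
qed

lemma exec_While_False:
  assumes "\<not> bval F b s"
  shows "exec F x u (While b P) s 1 s"
  using assms by (simp add: exec_Suc_iff exec_0_iff)

text \<open>The two additional steps are the evaluation of the guard and the passage from the
  finished body back to the loop.\<close>

lemma exec_While_True:
  assumes "bval F b s" "exec F x u P s k s1" "exec F x u (While b P) s1 m s2"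
  shows "exec F x u (While b P) s (k + m + 2) s2"
  using exec_Sequence[OF assms(2,3)] assms(1) by (simp add: exec_Suc_iff)

lemma exec_halts:
  assumes "exec F x u P (init n) k s"
  shows "halts P F n x u" "run_time P F n x u = k" "final_state P F n x u = s"
proof -
  have run: "fst (run P F n x u k) = Skip" "snd (run P F n x u k) = s"
    using assms by (simp_all add: exec_def run_def)
  then show "halts P F n x u"
    unfolding halts_def by blast
  show time: "run_time P F n x u = k"
    unfolding run_time_def
  proof (rule Least_equality)
    fix j assume "fst (run P F n x u j) = Skip"
    then show "k \<le> j"
      using assms by (auto simp: exec_def run_def not_less[symmetric])
  qed (rule run)
  show "final_state P F n x u = s"
    using run time by (simp add: final_state_def)
qed

section \<open>The candidate process\<close>

text \<open>
  The pair of the number of accepted positive tests (the level) and the last accepted box; box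
  \<open>1\<close> is the default at level \<open>0\<close>.
\<close>

primrec candidate :: "(nat \<Rightarrow> real set) \<Rightarrow> (nat \<Rightarrow> real) \<Rightarrow> nat \<Rightarrow> nat \<times> nat" where
  "candidate S x 0 = (0, 1)"
| "candidate S x (Suc k) =
     (if x (Suc k) \<in> S (fst (candidate S x k)) then (Suc (fst (candidate S x k)), Suc k)
      else candidate S x k)"

section \<open>Distribution of the final level\<close>

text \<open>Law after \<open>k\<close> steps of the pure birth chain that starts at \<open>0\<close>
  and moves from \<open>l\<close> to \<open>Suc l\<close> with probability
  \<open>q l\<close>.\<close>

primrec level_prob :: "(nat \<Rightarrow> real) \<Rightarrow> nat \<Rightarrow> nat \<Rightarrow> real" where
  "level_prob q 0 l = (if l = 0 then 1 else 0)"
| "level_prob q (Suc k) l =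
     (1 - q l) * level_prob q k l + (case l of 0 \<Rightarrow> 0 | Suc m \<Rightarrow> q m * level_prob q k m)"

section \<open>Range and measurability of the candidate\<close>

lemma snd_candidate_le: "snd (candidate S x k) \<le> max 1 k"
  by (induction k) auto

lemma snd_candidate_ge: "1 \<le> snd (candidate S x k)"
  by (induction k) auto

text \<open>At a positive level the candidate is a box already tested; the default box
  \<open>1\<close> at \<open>k = 0\<close> is not.\<close>

lemma snd_candidate_le_if: "0 < fst (candidate S x k) \<Longrightarrow> snd (candidate S x k) \<le> k"
  by (induction k) auto

lemma candidate_upd: "k < i \<Longrightarrow> candidate S (x(i := y)) k = candidate S x k"
  by (induction k) auto

lemma measurable_candidate:
  assumes S: "\<And>l. S l \<in> sets borel" and F: "sets F = sets borel" and "k \<le> m"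
  shows "(\<lambda>x. candidate S x k) \<in> PiM {1..m} (\<lambda>_. F) \<rightarrow>\<^sub>M count_space UNIV"
  using \<open>k \<le> m\<close>
proof (induction k)
  case (Suc k)
  then have IH[measurable]: "(\<lambda>x. candidate S x k) \<in> PiM {1..m} (\<lambda>_. F) \<rightarrow>\<^sub>M count_space UNIV"
    by simp
  have [measurable]: "(\<lambda>x. x (Suc k)) \<in> PiM {1..m} (\<lambda>_. F) \<rightarrow>\<^sub>M borel"
    using measurable_component_singleton[of "Suc k" "{1..m}" "\<lambda>_. F"] Suc.prems
    by (simp add: measurable_cong_sets[OF refl F])
  \<comment> \<open>The acceptance set depends on the random level; as levels are countable, one
    fixed set can be treated at a time.\<close>
  have "Measurable.pred (PiM {1..m} (\<lambda>_. F)) (\<lambda>x. x (Suc k) \<in> S (fst (candidate S x k)))"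
    by (rule measurable_compose_countable[where f = "\<lambda>c x. x (Suc k) \<in> S (fst c)" and g = "\<lambda>x. candidate S x k"])
      (use S in measurable)
  note [measurable] = this
  show ?case
    unfolding candidate.simps by measurable
qed simp

text \<open>The coordinate that is read is random, but it ranges over the finite set
  \<open>{1..m}\<close>, which contains the default box because \<open>1 \<le> m\<close>.\<close>

lemma measurable_candidate_value:
  assumes S: "\<And>l. S l \<in> sets borel" and F: "sets F = sets borel" and "k \<le> m" "1 \<le> m"
  shows "(\<lambda>x. x (snd (candidate S x k))) \<in> PiM {1..m} (\<lambda>_. F) \<rightarrow>\<^sub>M borel"
proof -
  note [measurable] = measurable_candidate[OF S F \<open>k \<le> m\<close>]
  have "(\<lambda>x. x (snd (candidate S x k))) \<in> PiM {1..m} (\<lambda>_. F) \<rightarrow>\<^sub>M F"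
  proof (rule measurable_compose_countable'[where I = "{1..m}" and f = "\<lambda>i x. x i"])
    have "(\<lambda>x. snd (candidate S x k)) \<in> PiM {1..m} (\<lambda>_. F) \<rightarrow>\<^sub>M count_space UNIV"
      by (rule measurable_compose[OF measurable_candidate[OF S F \<open>k \<le> m\<close>]]) simp
    moreover have "snd (candidate S x k) \<in> {1..m}" for x
      using snd_candidate_le[of S x k] snd_candidate_ge[of S x k] assms(3,4) by auto
    ultimately show "(\<lambda>x. snd (candidate S x k)) \<in> PiM {1..m} (\<lambda>_. F) \<rightarrow>\<^sub>M count_space {1..m}"
      by (auto simp: measurable_count_space_eq2_countable measurable_count_space_eq2)
  qed auto
  then show ?thesis by (simp add: measurable_cong_sets[OF refl F])
qed

text \<open>Independence of the last coordinate, by Fubini: an event that ignores it has the same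
  mass in the smaller product.\<close>

lemma measure_PiM_Suc:
  assumes F: "prob_space F" "sets F = sets borel"
    and A: "{x \<in> space (PiM {1..Suc k} (\<lambda>_. F)). A x} \<in> sets (PiM {1..Suc k} (\<lambda>_. F))"
      "{x \<in> space (PiM {1..k} (\<lambda>_. F)). A x} \<in> sets (PiM {1..k} (\<lambda>_. F))"
    and upd: "\<And>x y. A (x(Suc k := y)) \<longleftrightarrow> A x" and B: "B \<in> sets borel"
  shows "measure (PiM {1..Suc k} (\<lambda>_. F)) {x \<in> space (PiM {1..Suc k} (\<lambda>_. F)). A x \<and> x (Suc k) \<in> B} =
    measure (PiM {1..k} (\<lambda>_. F)) {x \<in> space (PiM {1..k} (\<lambda>_. F)). A x} * measure F B"
proof -
  let ?M = "\<lambda>k. PiM {1..k} (\<lambda>_. F)"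
  interpret product_prob_space "\<lambda>_. F" by (rule product_prob_spaceI) (rule F)
  have ins: "{1..Suc k} = insert (Suc k) {1..k}" by auto
  have spF: "space F = UNIV" using F(2) sets_eq_imp_space_eq by fastforce
  have [measurable]: "(\<lambda>x. x (Suc k)) \<in> ?M (Suc k) \<rightarrow>\<^sub>M borel"
    using measurable_component_singleton[of "Suc k" "{1..Suc k}" "\<lambda>_. F"]
    by (simp add: measurable_cong_sets[OF refl F(2)])
  have [measurable]: "Measurable.pred (?M (Suc k)) A" "Measurable.pred (?M k) A" 
    using A by (simp_all add: pred_def)
  note B[measurable]
  have BF: "B \<in> sets F" using B F by simp
  let ?X = "{x \<in> space (?M (Suc k)). A x \<and> x (Suc k) \<in> B}"
  have ind: "(indicator ?X :: _ \<Rightarrow> ennreal) \<in> borel_measurable (?M (Suc k))"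
    by measurable
  have "emeasure (?M (Suc k)) ?X = (\<integral>\<^sup>+ x. indicator ?X x \<partial>?M (Suc k))"
    by (rule nn_integral_indicator[symmetric]) measurable
  also have "\<dots> = (\<integral>\<^sup>+ x. (\<integral>\<^sup>+ y. indicator ?X (x(Suc k := y)) \<partial>F) \<partial>?M k)"
    unfolding ins by (rule product_nn_integral_insert) (simp, simp, rule ind[unfolded ins])
  also have "\<dots> = (\<integral>\<^sup>+ x. (\<integral>\<^sup>+ y. indicator {x \<in> space (?M k). A x} x * indicator B y \<partial>F) \<partial>?M k)"
    by (intro nn_integral_cong)
      (auto simp: indicator_def upd spF space_PiM PiE_def extensional_def)
  also have "\<dots> = emeasure (?M k) {x \<in> space (?M k). A x} * emeasure F B"
    by (simp only: nn_integral_cmult_indicator[OF BF]) (simp add: nn_integral_multc A del: One_nat_def)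
  finally show ?thesis by (simp add: measure_def enn2real_mult)
qed

section \<open>Joint law of the level and the value of the candidate\<close>

locale candidate_process = prob_space F for F :: "real measure" +
  fixes S :: "nat \<Rightarrow> real set"
  assumes sets_F: "sets F = sets borel" and sets_S: "S l \<in> sets borel"
begin

definition level_mass :: "nat \<Rightarrow> nat \<Rightarrow> real set \<Rightarrow> real" where
  "level_mass k l B = measure (PiM {1..k} (\<lambda>_. F))
     {x \<in> space (PiM {1..k} (\<lambda>_. F)). fst (candidate S x k) = l \<and> x (snd (candidate S x k)) \<in> B}"

lemma level_sets:
  assumes "k \<le> m"
  shows "{x \<in> space (PiM {1..m} (\<lambda>_. F)). fst (candidate S x k) = l} \<in> sets (PiM {1..m} (\<lambda>_. F))"
proof -
  note [measurable] = measurable_candidate[OF sets_S sets_F assms]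
  show ?thesis by measurable
qed

lemma level_value_sets:
  assumes "k \<le> m" "B \<in> sets borel"
  shows "{x \<in> space (PiM {1..m} (\<lambda>_. F)). fst (candidate S x k) = Suc l \<and> x (snd (candidate S x k)) \<in> B}
    \<in> sets (PiM {1..m} (\<lambda>_. F))"
proof (cases "1 \<le> m")
  case True
  note [measurable] = measurable_candidate[OF sets_S sets_F assms(1)]
    measurable_candidate_value[OF sets_S sets_F assms(1) True] assms(2)
  show ?thesis by measurable
next
  case False
  then have "k = 0" using assms(1) by simp
  then show ?thesis by simp
qed

text \<open>At a positive level the candidate is among the first \<open>k\<close> boxes, so the next
  coordinate affects neither it nor its value. At level \<open>0\<close> this would fail for
  \<open>k = 0\<close>, where the default box is \<open>Suc k\<close>.\<close>

lemma level_value_upd: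
  "fst (candidate S (x(Suc k := y)) k) = Suc l \<and>
      (x(Suc k := y)) (snd (candidate S (x(Suc k := y)) k)) \<in> B \<longleftrightarrow>
   fst (candidate S x k) = Suc l \<and> x (snd (candidate S x k)) \<in> B"
  using snd_candidate_le_if[of S x k] by (auto simp: candidate_upd)

lemma prob_not_S: "prob (- S l) = 1 - prob (S l)"
proof -
  have "space F = UNIV" using sets_F sets_eq_imp_space_eq by fastforce
  then show ?thesis using prob_compl[of "S l"] sets_S sets_F by (simp add: Compl_eq_Diff_UNIV)
qed

lemma level_mass_0:
  "level_mass k 0 UNIV = (1 - prob (S 0)) ^ k"
proof (induction k)
  case 0
  interpret P: prob_space "PiM {1..0::nat} (\<lambda>_. F)"
    by (rule prob_space_PiM) (rule prob_space_axioms)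
  show ?case using P.prob_space by (simp add: level_mass_def)
next
  case (Suc k)
  have "level_mass (Suc k) 0 UNIV = measure (PiM {1..Suc k} (\<lambda>_. F))
      {x \<in> space (PiM {1..Suc k} (\<lambda>_. F)). fst (candidate S x k) = 0 \<and> x (Suc k) \<in> - S 0}"
    unfolding level_mass_def by (intro arg_cong[where f = "measure _"]) auto
  also have "\<dots> = level_mass k 0 UNIV * prob (- S 0)"
    unfolding level_mass_def
    by (subst measure_PiM_Suc)
      (auto intro!: level_sets borel_comp sets_S prob_space_axioms sets_F simp: candidate_upd simp del: One_nat_def)
  finally show ?case using Suc by (simp add: prob_not_S)
qed

lemma level_mass_start: "level_mass 0 (Suc l) B = 0"
  by (simp add: level_mass_def)

text \<open>Level \<open>Suc l\<close> arises in two disjoint ways: it was reached before and the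
  new box is rejected (\<open>?X\<close>), or the level was \<open>l\<close> and the new box is
  accepted (\<open>?Y\<close>). In the second case the old candidate is replaced, so its value is
  unrestricted, whence \<open>UNIV\<close>.\<close>

lemma level_mass_Suc:
  assumes B: "B \<in> sets borel"
  shows "level_mass (Suc k) (Suc l) B =
    (1 - prob (S (Suc l))) * level_mass k (Suc l) B + prob (S l \<inter> B) * level_mass k l UNIV"
proof -
  let ?M = "\<lambda>k. PiM {1..k} (\<lambda>_. F)"
  let ?A = "\<lambda>x. fst (candidate S x k) = Suc l \<and> x (snd (candidate S x k)) \<in> B"
  let ?X = "{x \<in> space (?M (Suc k)). ?A x \<and> x (Suc k) \<in> - S (Suc l)}"
  let ?Y = "{x \<in> space (?M (Suc k)). fst (candidate S x k) = l \<and> x (Suc k) \<in> S l \<inter> B}"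
  interpret P: prob_space "?M (Suc k)"
    by (rule prob_space_PiM) (rule prob_space_axioms)
  have sets_comp: "- S (Suc l) \<in> sets borel" "S l \<inter> B \<in> sets borel"
    using sets_S B by auto
  have coord: "(\<lambda>x. x (Suc k)) \<in> ?M (Suc k) \<rightarrow>\<^sub>M borel"
    using measurable_component_singleton[of "Suc k" "{1..Suc k}" "\<lambda>_. F"]
    by (simp add: measurable_cong_sets[OF refl sets_F])
  have coord_sets: "{x \<in> space (?M (Suc k)). x (Suc k) \<in> C} \<in> sets (?M (Suc k))" if "C \<in> sets borel" for C
    using measurable_sets[OF coord that] by (simp add: vimage_def Int_def conj_commute)
  have X: "?X \<in> sets (?M (Suc k))"
  proof -
    have "?X = {x \<in> space (?M (Suc k)). ?A x} \<inter> {x \<in> space (?M (Suc k)). x (Suc k) \<in> - S (Suc l)}"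
      by auto
    also have "\<dots> \<in> sets (?M (Suc k))"
      using B sets_comp by (intro sets.Int level_value_sets coord_sets) auto
    finally show ?thesis .
  qed
  have Y: "?Y \<in> sets (?M (Suc k))"
  proof -
    have "?Y = {x \<in> space (?M (Suc k)). fst (candidate S x k) = l}
        \<inter> {x \<in> space (?M (Suc k)). x (Suc k) \<in> S l \<inter> B}"
      by auto
    also have "\<dots> \<in> sets (?M (Suc k))"
      using B sets_comp by (intro sets.Int level_sets coord_sets) (auto intro: sets_S)
    finally show ?thesis .
  qed
  have "level_mass (Suc k) (Suc l) B = P.prob (?X \<union> ?Y)"
    unfolding level_mass_def by (intro arg_cong[where f = "measure _"]) auto
  also have "\<dots> = P.prob ?X + P.prob ?Y"
    by (rule P.finite_measure_Union[OF X Y]) auto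
  also have "P.prob ?X = level_mass k (Suc l) B * prob (- S (Suc l))"
    unfolding level_mass_def
    by (rule measure_PiM_Suc)
      (use B sets_comp in \<open>auto intro!: level_value_sets level_value_upd prob_space_axioms sets_F simp del: One_nat_def fun_upd_apply\<close>)
  also have "P.prob ?Y = level_mass k l UNIV * prob (S l \<inter> B)"
    unfolding level_mass_def iso_tuple_UNIV_I simp_thms
    by (rule measure_PiM_Suc)
      (use sets_comp in \<open>auto intro!: level_sets prob_space_axioms sets_F sets_S simp: candidate_upd simp del: One_nat_def\<close>)
  finally show ?thesis by (simp add: prob_not_S mult.commute)
qed

lemma level_mass_UNIV: "level_mass k l UNIV = level_prob (\<lambda>l. prob (S l)) k l"
proof (induction k arbitrary: l)
  case 0
  show ?case by (cases l) (use level_mass_0[of 0] in \<open>auto simp: level_mass_start\<close>)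
next
  case (Suc k)
  show ?case 
  proof (cases l)
    case 0
    then show ?thesis using level_mass_0[of "Suc k"] level_mass_0[of k] Suc[of 0] by simp
  next
    case (Suc l')
    then show ?thesis using Suc.IH by (simp add: level_mass_Suc)
  qed
qed

text \<open>Whenever the acceptance happens, the accepted value has law \<open>F\<close> conditioned
  on \<open>S l\<close>; this constant factor passes through the recursion.\<close>

lemma level_mass_eq:
  assumes "B \<in> sets borel" "prob (S l) \<noteq> 0"
  shows "level_mass k (Suc l) B = level_prob (\<lambda>l. prob (S l)) k (Suc l) * prob (S l \<inter> B) / prob (S l)"
  using assms by (induction k) (simp_all add: level_mass_start level_mass_Suc level_mass_UNIV field_simps)

text \<open>The levels are disjoint events. Level \<open>0\<close> and levels above \<open>m\<close>
  are dropped, hence only an inequality.\<close>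

lemma sum_level_mass_le:
  assumes "B \<in> sets borel" "1 \<le> k"
  shows "(\<Sum>l<m. level_mass k (Suc l) B) \<le>
    measure (PiM {1..k} (\<lambda>_. F)) {x \<in> space (PiM {1..k} (\<lambda>_. F)). x (snd (candidate S x k)) \<in> B}"
proof -
  let ?M = "PiM {1..k} (\<lambda>_. F)"
  interpret P: prob_space ?M
    by (rule prob_space_PiM) (rule prob_space_axioms)
  have sets: "{x \<in> space ?M. x (snd (candidate S x k)) \<in> B} \<in> P.events"
    using measurable_sets[OF measurable_candidate_value[where S = S, OF sets_S sets_F order.refl assms(2)] assms(1)]
    by (simp add: vimage_def Int_def conj_commute)
  have "(\<Sum>l<m. level_mass k (Suc l) B) = P.prob (\<Union>l<m.
      {x \<in> space ?M. fst (candidate S x k) = Suc l \<and> x (snd (candidate S x k)) \<in> B})"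
    unfolding level_mass_def
    by (rule P.finite_measure_finite_Union[symmetric])
      (use assms in \<open>auto simp: disjoint_family_on_def intro!: level_value_sets simp del: One_nat_def\<close>)
  also have "\<dots> \<le> P.prob {x \<in> space ?M. x (snd (candidate S x k)) \<in> B}"
    by (rule P.finite_measure_mono[OF _ sets]) auto
  finally show ?thesis .
qed

end

section \<open>Tails and quantiles\<close>

text \<open>Fubini on the region where \<open>t\<close> is positive and at most \<open>f x\<close>;
  negative values of \<open>f\<close> count as \<open>0\<close> on both sides.\<close>

lemma nn_integral_layer_cake:
  fixes f :: "'a \<Rightarrow> real"
  assumes "sigma_finite_measure M" and f[measurable]: "f \<in> borel_measurable M"
  shows "(\<integral>\<^sup>+ x. ennreal (f x) \<partial>M) = (\<integral>\<^sup>+ t. emeasure M {x \<in> space M. t \<le> f x} * indicator {0<..} t \<partial>lborel)"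
proof -
  interpret pair_sigma_finite M lborel
    using assms(1) by (simp add: pair_sigma_finite_def lborel.sigma_finite_measure_axioms)
  have "(\<integral>\<^sup>+ x. ennreal (f x) \<partial>M) = (\<integral>\<^sup>+ x. (\<integral>\<^sup>+ t. indicator {0<..} t * indicator {..f x} t \<partial>lborel) \<partial>M)"
  proof (rule nn_integral_cong)
    fix x
    have "(\<integral>\<^sup>+ t. indicator {0<..} t * indicator {..f x} t \<partial>lborel) = (\<integral>\<^sup>+ t. indicator {0<..f x} t \<partial>lborel)"
      by (intro nn_integral_cong) (auto simp: indicator_def)
    also have "\<dots> = ennreal (f x)"
      by (cases "0 \<le> f x") (simp_all add: ennreal_neg)
    finally show "ennreal (f x) = (\<integral>\<^sup>+ t. indicator {0<..} t * indicator {..f x} t \<partial>lborel)" ..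
  qed
  also have "\<dots> = (\<integral>\<^sup>+ t. (\<integral>\<^sup>+ x. indicator {0<..} t * indicator {..f x} t \<partial>M) \<partial>lborel)"
    by (rule Fubini'[symmetric]) (measurable, simp, measurable)
  also have "\<dots> = (\<integral>\<^sup>+ t. emeasure M {x \<in> space M. t \<le> f x} * indicator {0<..} t \<partial>lborel)"
  proof (rule nn_integral_cong)
    fix t :: real
    have "(\<integral>\<^sup>+ x. indicator {0<..} t * indicator {..f x} t \<partial>M) =
        (\<integral>\<^sup>+ x. indicator {0<..} t * indicator {x \<in> space M. t \<le> f x} x \<partial>M)"
      by (intro nn_integral_cong) (auto simp: indicator_def)
    then show "(\<integral>\<^sup>+ x. indicator {0<..} t * indicator {..f x} t \<partial>M) =
        emeasure M {x \<in> space M. t \<le> f x} * indicator {0<..} t"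
      by (simp add: nn_integral_cmult mult.commute)
  qed
  finally show ?thesis .
qed

lemma measurable_upper_tail:
  fixes f :: "'a \<Rightarrow> real"
  assumes "sigma_finite_measure M" and f[measurable]: "f \<in> borel_measurable M"
  shows "(\<lambda>t. emeasure M {x \<in> space M. t \<le> f x}) \<in> borel_measurable borel"
proof -
  interpret sigma_finite_measure M by fact
  show ?thesis by measurable
qed

section \<open>Tails and quantiles of a continuous distribution\<close>

context
  fixes F :: "real measure"
  assumes F: "continuous_nonneg_distribution F"
begin

interpretation real_distribution F
  using F by (simp add: continuous_nonneg_distribution_def)

text \<open>Continuity excludes an atom at \<open>0\<close>, which extends the claim from negative
  \<open>t\<close> to \<open>t = 0\<close>, the left end of the intermediate value argument in
  \<open>cdf_quantile\<close>.\<close>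

lemma cdf_neg_eq_0: "t \<le> 0 \<Longrightarrow> cdf F t = 0"
proof -
  assume "t \<le> 0"
  have "prob {0} = 0"
    using F by (simp add: continuous_nonneg_distribution_def continuous_on_eq_continuous_at isCont_cdf)
  have "AE x in F. 0 < x"
  proof -
    have "AE x in F. x \<notin> {0}"
      using \<open>prob {0} = 0\<close> by (intro AE_not_in) (simp add: null_sets_def emeasure_eq_measure)
    moreover have "AE x in F. 0 \<le> x" using F by (simp add: continuous_nonneg_distribution_def)
    ultimately show ?thesis by eventually_elim auto
  qed
  then have "AE x in F. x \<notin> {..t}" using \<open>t \<le> 0\<close> by (auto elim!: eventually_mono)
  then have "emeasure F {..t} = 0"
    by (subst AE_iff_measurable[symmetric, where P = "\<lambda>x. x \<notin> {..t}"]) auto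
  then show ?thesis by (simp add: cdf_def measure_def)
qed

lemma prob_atLeast: "prob {t..} = 1 - cdf F t"
proof -
  have "prob {t} = 0"
    using F by (simp add: continuous_nonneg_distribution_def continuous_on_eq_continuous_at isCont_cdf)
  have "prob {..t} = prob {..<t} + prob {t}"
    by (subst finite_measure_Union[symmetric]) (auto intro: arg_cong[where f = prob])
  moreover have "prob {t..} = 1 - prob {..<t}"
    using prob_compl[of "{..<t}"] by (simp add: Compl_eq_Diff_UNIV[symmetric])
  ultimately show ?thesis using \<open>prob {t} = 0\<close> by (simp add: cdf_def)
qed

lemma quantile_set_nonempty: "p < 1 \<Longrightarrow> \<exists>x\<ge>0. p \<le> cdf F x"
proof -
  assume "p < 1"
  then have "\<forall>\<^sub>F x in at_top. p < cdf F x"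
    using cdf_lim_at_top_prob order_tendstoD(1) by blast
  then have "\<forall>\<^sub>F x in at_top. p < cdf F x \<and> 0 \<le> x"
    using eventually_ge_at_top by (rule eventually_conj)
  then show ?thesis
    using eventually_happens[of _ "at_top :: real filter"] by fastforce
qed

lemma quantile_nonneg: "0 \<le> quantile F p"
proof (cases "p < 1")
  case True
  then have "0 \<le> Inf {x. 0 \<le> x \<and> p \<le> cdf F x}"
    using quantile_set_nonempty[OF True] by (intro cInf_greatest) auto
  then show ?thesis using True by (simp add: quantile_def)
qed (simp add: quantile_def)

text \<open>The set \<open>?Q\<close> is closed and so contains its infimum, which gives at least
  \<open>p\<close>; the intermediate value theorem gives a member with value exactly
  \<open>p\<close>, and monotonicity bounds the infimum by it.\<close>

lemma cdf_quantile:
  assumes "0 \<le> p" "p < 1"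
  shows "cdf F (quantile F p) = p"
proof -
  let ?Q = "{x. 0 \<le> x \<and> p \<le> cdf F x}"
  have cont: "continuous_on A (cdf F)" for A
    using F continuous_on_subset[of UNIV "cdf F" A] by (simp add: continuous_nonneg_distribution_def)
  have bdd: "bdd_below ?Q" by (auto simp: bdd_below_def)
  obtain b where b: "0 \<le> b" "p \<le> cdf F b" using quantile_set_nonempty[OF assms(2)] by auto
  have "closed ?Q"
    using cont by (auto intro!: closed_Collect_conj closed_Collect_le)
  then have "Inf ?Q \<in> ?Q"
    using b bdd by (intro closed_contains_Inf) auto
  moreover have "\<exists>x\<ge>0. x \<le> b \<and> cdf F x = p"
    by (rule IVT') (use b assms cont cdf_neg_eq_0[of 0] in auto)
  then obtain x where x: "0 \<le> x" "cdf F x = p" by blast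
  then have "Inf ?Q \<le> x" by (intro cInf_lower bdd) auto
  then have "cdf F (Inf ?Q) \<le> p" using x cdf_nondecreasing by auto
  ultimately show ?thesis using assms by (simp add: quantile_def)
qed

lemma prob_atLeast_quantile: 
  assumes "0 < q" "q \<le> 1"
  shows "prob {quantile F (1 - q)..} = q"
  using cdf_quantile[of "1 - q"] assms by (simp add: prob_atLeast)

lemma prob_atLeast_Int: "prob ({s..} \<inter> {t..}) = min (prob {s..}) (prob {t..})"
proof -
  have "prob {max s t..} = min (prob {s..}) (prob {t..})"
    by (cases "s \<le> t") (auto simp: max_def min_def finite_measure_mono intro!: antisym)
  moreover have "{s..} \<inter> {t..} = {max s t..}" by auto
  ultimately show ?thesis by simp
qed

lemma measure_max_ge:
  assumes "1 \<le> n"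
  shows "measure (PiM {1..n} (\<lambda>_. F)) {x \<in> space (PiM {1..n} (\<lambda>_. F)). t \<le> Max (x ` {1..n})} =
    1 - (1 - prob {t..}) ^ n"
proof -
  let ?M = "PiM {1..n} (\<lambda>_. F)"
  interpret P: finite_product_prob_space "\<lambda>_. F" "{1..n}"
    by standard auto
  have "{x \<in> space ?M. t \<le> Max (x ` {1..n})} = space ?M - (\<Pi>\<^sub>E i\<in>{1..n}. {..<t})"
    using assms by (auto simp: space_PiM PiE_def Pi_def extensional_def Max_ge_iff not_less)
  moreover have "P.prob (\<Pi>\<^sub>E i\<in>{1..n}. {..<t}) = prob {..<t} ^ n"
    by (subst P.prob_times) auto
  moreover have "prob {..<t} = 1 - prob {t..}"
    using prob_compl[of "{t..}"] by (simp add: Compl_eq_Diff_UNIV[symmetric])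
  moreover have "P.prob (space ?M - (\<Pi>\<^sub>E i\<in>{1..n}. {..<t})) = 1 - P.prob (\<Pi>\<^sub>E i\<in>{1..n}. {..<t})"
    by (rule P.prob_compl) (auto intro!: sets_PiM_I_finite)
  ultimately show ?thesis by simp
qed

end

section \<open>The limit guarantee\<close>

text \<open>
  A numerical optimum of the smallest ratio of the guarantee to \<open>1 - exp (- z)\<close>, for three levels.
\<close>

definition rates :: "nat \<Rightarrow> real" where
  "rates = (\<lambda>_. 0)(0 := 2035 / 1000, 1 := 506 / 1000, 2 := 57 / 1000)"

text \<open>The Lagrange remainder of the alternating series has a sign given by the parity of its
  degree.\<close>

lemma exp_neg_bounds:
  fixes x :: real
  assumes "0 < x"
  shows "exp (-x) \<ge> (\<Sum>m<2*n. (-x)^m / fact m)" "exp (-x) \<le> (\<Sum>m<Suc (2*n). (-x)^m / fact m)"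
proof -
  obtain t where "exp (-x) = (\<Sum>m<2*n. (-x)^m / fact m) + exp t / fact (2*n) * (-x)^(2*n)"
    using Maclaurin_exp_le by blast
  moreover have "0 \<le> exp t / fact (2*n) * (-x)^(2*n)"
    by (intro mult_nonneg_nonneg) auto
  ultimately show "exp (-x) \<ge> (\<Sum>m<2*n. (-x)^m / fact m)" by linarith
  obtain t where "exp (-x) = (\<Sum>m<Suc (2*n). (-x)^m / fact m) + exp t / fact (Suc (2*n)) * (-x)^(Suc (2*n))"
    using Maclaurin_exp_le by blast
  moreover have "exp t / fact (Suc (2*n)) * (-x)^(Suc (2*n)) \<le> 0"
    using assms by (intro mult_nonneg_nonpos) auto
  ultimately show "exp (-x) \<le> (\<Sum>m<Suc (2*n). (-x)^m / fact m)" by linarith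
qed

text \<open>The arguments are the three rates and the two points of tangency in
  \<open>eventually_level_bounds\<close>.\<close>

lemma exp_bounds:
  "exp (- (2035/1000)) \<in> {0.130680 .. 0.130681::real}"
  "exp (- (506/1000)) \<in> {0.602902 .. 0.602903::real}"
  "exp (- (57/1000)) \<in> {0.944594 .. 0.9445941::real}"
  "exp (- (1035/1000)) \<in> {0.355226 .. 0.355227::real}"
  "exp (- (116/1000)) \<in> {0.890475 .. 0.890476::real}"
  using exp_neg_bounds[of "2035/1000" 8] exp_neg_bounds[of "506/1000" 5] exp_neg_bounds[of "57/1000" 3]
    exp_neg_bounds[of "1035/1000" 6] exp_neg_bounds[of "116/1000" 3]
  by (simp_all add: eval_nat_numeral fact_numeral)

text \<open>Convexity of the power without derivatives: the induction step leaves the nonnegative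
  slack \<open>real n * y ^ (n - 1) * (x - y)\<^sup>2\<close>.\<close>

lemma power_ge_tangent:
  fixes x y :: real
  assumes "0 \<le> x" "0 \<le> y"
  shows "y ^ n + real n * y ^ (n - 1) * (x - y) \<le> x ^ n"
proof (induction n)
  case (Suc n)
  have *: "y ^ Suc n + real (Suc n) * y ^ n * (x - y) + real n * y ^ (n - 1) * (x - y)\<^sup>2 =
        x * (y ^ n + real n * y ^ (n - 1) * (x - y))"
    by (cases n) (simp_all add: algebra_simps power2_eq_square)
  have "0 \<le> real n * y ^ (n - 1) * (x - y)\<^sup>2"
    using assms by simp
  then have "y ^ Suc n + real (Suc n) * y ^ n * (x - y) \<le> x * x ^ n"
    using * mult_left_mono[OF Suc.IH assms(1)] by linarith
  then show ?case by simp
qed simp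

text \<open>The recursion is triangular with eigenvalues \<open>1 - q l\<close>, so its solutions
  combine their powers; the last coefficient makes the value at \<open>k = 0\<close> vanish. The
  equations for the coefficients, unlike quotients, also make sense when all \<open>q l\<close> are
  \<open>0\<close>.\<close>

lemma level_prob_closed:
  fixes C D0 D1 :: real
  assumes "C * (q 0 - q 1) = q 0" "D0 * (q 0 - q 2) = q 1 * C" "D1 * (q 1 - q 2) = - q 1 * C"
  shows "level_prob q k 0 = (1 - q 0) ^ k"
    and "level_prob q k 1 = C * ((1 - q 1) ^ k - (1 - q 0) ^ k)"
    and "level_prob q k 2 = D0 * (1 - q 0) ^ k + D1 * (1 - q 1) ^ k - (D0 + D1) * (1 - q 2) ^ k"
proof -
  show 0: "level_prob q k 0 = (1 - q 0) ^ k" for k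
    by (induction k) simp_all
  show 1: "level_prob q k 1 = C * ((1 - q 1) ^ k - (1 - q 0) ^ k)" for k
  proof (induction k)
    case (Suc k)
    have "level_prob q (Suc k) 1 = (1 - q 1) * level_prob q k 1 + q 0 * level_prob q k 0"
      by simp
    moreover have "(1 - q 1) * (C * (y - x)) + q 0 * x = C * ((1 - q 1) * y - (1 - q 0) * x)" for x y
      using arg_cong[OF assms(1), of "\<lambda>c. c * x"] by (simp add: algebra_simps)
    ultimately show ?case
      unfolding Suc 0 power_Suc by simp
  qed simp
  show "level_prob q k 2 = D0 * (1 - q 0) ^ k + D1 * (1 - q 1) ^ k - (D0 + D1) * (1 - q 2) ^ k" for k
  proof (induction k)
    case (Suc k)
    have "level_prob q (Suc k) 2 = (1 - q 2) * level_prob q k 2 + q 1 * level_prob q k 1"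
      by (simp add: numeral_2_eq_2)
    moreover have "(1 - q 2) * (D0 * x + D1 * y - (D0 + D1) * z) + q 1 * (C * (y - x)) =
        D0 * ((1 - q 0) * x) + D1 * ((1 - q 1) * y) - (D0 + D1) * ((1 - q 2) * z)" for x y z
      using arg_cong[OF assms(2), of "\<lambda>c. c * x"] arg_cong[OF assms(3), of "\<lambda>c. c * y"]
      by (simp add: algebra_simps)
    ultimately show ?case
      unfolding Suc 1 power_Suc by simp
  qed simp
qed

text \<open>Level \<open>3\<close> is absorbing, so no mass leaves the levels \<open>0\<close> to
  \<open>3\<close>.\<close>

lemma sum_level_prob:
  assumes "q 3 = 0"
  shows "level_prob q k 0 + level_prob q k 1 + level_prob q k 2 + level_prob q k 3 = 1"
  using assms by (induction k) (simp_all add: numeral_2_eq_2 numeral_3_eq_3 algebra_simps)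

text \<open>The coefficients are those of \<open>level_prob_closed\<close>; the factor \<open>1 / n\<close> cancels.\<close>

lemma level_prob_rates:
  fixes k n :: nat
  defines "E \<equiv> \<lambda>l. (1 - rates l / real n) ^ k"
  shows "level_prob (\<lambda>l. rates l / real n) k 0 = E 0"
    and "level_prob (\<lambda>l. rates l / real n) k 1 = 185 / 139 * (E 1 - E 0)"
    and "level_prob (\<lambda>l. rates l / real n) k 2 =
      2035 / 5977 * E 0 - 93610 / 62411 * E 1 - (2035 / 5977 - 93610 / 62411) * E 2"
proof -
  let ?q = "\<lambda>l. rates l / real n"
  have "185 / 139 * (?q 0 - ?q 1) = ?q 0" "2035 / 5977 * (?q 0 - ?q 2) = ?q 1 * (185 / 139)"
    "- 93610 / 62411 * (?q 1 - ?q 2) = - ?q 1 * (185 / 139)"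
    unfolding diff_divide_distrib[symmetric] by (simp_all add: rates_def)
  note * = level_prob_closed[where q = ?q, OF this, of k]
  show "level_prob ?q k 0 = E 0" "level_prob ?q k 1 = 185 / 139 * (E 1 - E 0)"
    "level_prob ?q k 2 =
      2035 / 5977 * E 0 - 93610 / 62411 * E 1 - (2035 / 5977 - 93610 / 62411) * E 2"
    using * by (simp_all add: E_def)
qed

lemma linear_nonneg:
  fixes u v :: real
  assumes "0 \<le> u + v * l" "0 \<le> u + v * r" "l \<le> z" "z \<le> r"
  shows "0 \<le> u + v * z"
proof (cases "0 \<le> v")
  case True
  then show ?thesis using mult_left_mono[OF assms(3)] assms(1) by fastforce
next
  case False
  then show ?thesis using mult_left_mono_neg[OF assms(4), of v] assms(2) by fastforce
qed

text \<open>The exponent \<open>n - 1\<close> comes from the slope of a tangent to the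
  \<open>n\<close>-th power; dividing by \<open>1 - t / n\<close>, which tends to \<open>1\<close>,
  does not change the limit.\<close>

lemma power_limits:
  fixes t :: real
  shows "(\<lambda>n. (1 - t / real n) ^ n) \<longlonglongrightarrow> exp (- t)"
    and "(\<lambda>n. (1 - t / real n) ^ (n - 1)) \<longlonglongrightarrow> exp (- t)"
proof -
  show *: "(\<lambda>n. (1 - t / real n) ^ n) \<longlonglongrightarrow> exp (- t)"
    using tendsto_exp_limit_sequentially[of "-t"] by simp
  have "(\<lambda>n. (1 - t / real n) ^ n / (1 - t / real n)) \<longlonglongrightarrow> exp (- t) / (1 - 0)"
    by (intro tendsto_intros * lim_const_over_n) simp
  moreover have "\<forall>\<^sub>F n in sequentially.
      (1 - t / real n) ^ n / (1 - t / real n) = (1 - t / real n) ^ (n - 1)"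
  proof -
    have "\<forall>\<^sub>F n in sequentially. 0 < 1 - t / real n"
      by (intro order_tendstoD(1)[of _ 1]) (use lim_const_over_n[of t] in \<open>auto intro!: tendsto_eq_intros\<close>)
    then show ?thesis
      using eventually_gt_at_top[of 0]
    proof eventually_elim
      case (elim n)
      then show ?case by (cases n) auto
    qed
  qed
  ultimately show "(\<lambda>n. (1 - t / real n) ^ (n - 1)) \<longlonglongrightarrow> exp (- t)"
    using tendsto_cong by fastforce
qed

text \<open>Uniformity in \<open>p\<close> comes from reducing the claim to six inequalities free of
  \<open>p\<close> (\<open>above\<close>, \<open>slope\<close>, and two each from
  \<open>upper\<close> and \<open>lower\<close>). Each is strict in the limit, hence holds
  eventually.\<close>

lemma eventually_level_bounds:
  "\<forall>\<^sub>F n in sequentially. \<forall>p\<in>{0..1}.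
     0.869 * (1 - (1 - p) ^ n) \<le>
       (\<Sum>l<3. level_prob (\<lambda>l. rates l / real n) n (Suc l) * min p (rates l / real n) / (rates l / real n))"
proof -
  define w where "w l n = level_prob (\<lambda>l. rates l / real n) n l" for l n
  define E where "E t n = (1 - t / real n) ^ n" for t :: real and n
  define E' where "E' t n = (1 - t / real n) ^ (n - 1)" for t :: real and n
  define w1 :: real where "w1 = 185 / 139 * (exp (- rates 1) - exp (- rates 0))"
  define w2 :: real where "w2 = 2035 / 5977 * exp (- rates 0) - 93610 / 62411 * exp (- rates 1)
    - (2035 / 5977 - 93610 / 62411) * exp (- rates 2)"
  define w3 :: real where "w3 = 1 - exp (- rates 0) - w1 - w2"
  have E_lim: "(\<lambda>n. E t n) \<longlonglongrightarrow> exp (- t)" and E'_lim: "(\<lambda>n. E' t n) \<longlonglongrightarrow> exp (- t)" for t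
    unfolding E_def E'_def by (rule power_limits)+
  have w012_lim: "w 0 \<longlonglongrightarrow> exp (- rates 0)" "w 1 \<longlonglongrightarrow> w1" "w 2 \<longlonglongrightarrow> w2"
    unfolding w_def level_prob_rates w1_def w2_def by (intro tendsto_intros power_limits)+
  \<comment> \<open>Since \<open>rates 3 = 0\<close>, level \<open>3\<close> is absorbing and
    carries the remaining mass, which replaces a closed form for it.\<close>
  have "w 3 = (\<lambda>n. 1 - w 0 n - w 1 n - w 2 n)"
  proof
    fix n show "w 3 n = 1 - w 0 n - w 1 n - w 2 n"
      using sum_level_prob[of "\<lambda>l. rates l / real n" n] by (simp add: w_def rates_def)
  qed
  then have "w 3 \<longlonglongrightarrow> w3"
    unfolding w3_def by (simp only:) (intro tendsto_intros w012_lim)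
  note w_lim = w012_lim(2,3) this
  have sum_w: "w1 + w2 + w3 = 1 - exp (- (2035/1000))"
    unfolding w3_def by (simp add: rates_def)
  have ev: "\<forall>\<^sub>F n in sequentially. 0 < f n" if "f \<longlonglongrightarrow> l" "0 < l" for f and l :: real
    using order_tendstoD(1)[OF that] .
  have ev_tangent: "\<forall>\<^sub>F n in sequentially.
      0 < A n + B n * z - 0.869 * (1 - E t n + E' t n * (z - t))"
    if "A \<longlonglongrightarrow> a" "B \<longlonglongrightarrow> b" "0 < a + b * z - 0.869 * (1 - exp (- t) + exp (- t) * (z - t))"
    for A B a b and z t :: real
    by (rule ev[OF _ that(3)]) (intro tendsto_intros that E_lim E'_lim)
  \<comment> \<open>In the variable \<open>z = n p\<close> the tangent has slope
    \<open>E' t n\<close>, as the factor \<open>n\<close> of the derivative cancels;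
    \<open>t < n\<close> keeps the base nonnegative.\<close>
  have tangent: "1 - (1 - p) ^ n \<le> 1 - E t n + E' t n * (real n * p - t)"
    if "0 \<le> p" "p \<le> 1" "t < real n" "0 \<le> t" for p t :: real and n
  proof -
    have "0 < real n" using that by linarith
    then have "real n * (1 - t / real n) ^ (n - 1) * ((1 - p) - (1 - t / real n)) =
        - E' t n * (real n * p - t)"
      by (simp add: E'_def field_simps)
    then show ?thesis
      using power_ge_tangent[of "1 - p" "1 - t / real n" n] that \<open>0 < real n\<close>
      by (simp add: E_def)
  qed
  \<comment> \<open>For \<open>z\<close> above the largest rate every minimum is attained by the
    rate. The limit \<open>1 - exp (- 2.035)\<close> exceeds \<open>0.869\<close> by only about
    \<open>0.0003\<close>.\<close>
  have above: "\<forall>\<^sub>F n in sequentially. 0 < w 1 n + w 2 n + w 3 n - 0.869"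
    by (rule ev[where l = "w1 + w2 + w3 - 0.869"], intro tendsto_intros w_lim)
      (use sum_w exp_bounds in auto)
  \<comment> \<open>For \<open>z\<close> below the smallest rate the guarantee is linear through the
    origin and is compared with \<open>1 - (1 - p) ^ n \<le> z\<close>.\<close>
  have slope: "\<forall>\<^sub>F n in sequentially.
      0 < w 1 n / (2035/1000) + w 2 n / (506/1000) + w 3 n / (57/1000) - 0.869"
    by (rule ev[where l = "w1 / (2035/1000) + w2 / (506/1000) + w3 / (57/1000) - 0.869"],
        intro tendsto_intros w_lim)
      (use exp_bounds in \<open>auto simp: w1_def w2_def w3_def rates_def field_simps\<close>)
  \<comment> \<open>\<open>1 - (1 - p) ^ n\<close> is concave in \<open>z = n p\<close> and the guarantee is linear in \<open>z\<close> between two rates, so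
    it suffices to compare the guarantee with one tangent at both ends. The points of tangency
    \<open>1.035\<close> and \<open>0.116\<close> are near the points where the limit ratio is smallest.\<close>
  have upper: "\<forall>\<^sub>F n in sequentially. 0 < (w 2 n + w 3 n) + w 1 n / (2035/1000) * z
      - 0.869 * (1 - E (1035/1000) n + E' (1035/1000) n * (z - 1035/1000))"
    if "z = 506/1000 \<or> z = 2035/1000" for z
  proof (rule ev_tangent[where a = "w2 + w3" and b = "w1 / (2035/1000)"])
    show "0 < w2 + w3 + w1 / (2035/1000) * z
      - 0.869 * (1 - exp (- (1035/1000)) + exp (- (1035/1000)) * (z - 1035/1000))"
      using that exp_bounds
      by (elim disjE; hypsubst) (simp_all add: w1_def w2_def w3_def rates_def field_simps)
  qed (intro tendsto_intros w_lim; simp)+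
  have lower: "\<forall>\<^sub>F n in sequentially. 0 < w 3 n + (w 1 n / (2035/1000) + w 2 n / (506/1000)) * z
      - 0.869 * (1 - E (116/1000) n + E' (116/1000) n * (z - 116/1000))"
    if "z = 57/1000 \<or> z = 506/1000" for z
  proof (rule ev_tangent[where a = w3 and b = "w1 / (2035/1000) + w2 / (506/1000)"])
    show "0 < w3 + (w1 / (2035/1000) + w2 / (506/1000)) * z
      - 0.869 * (1 - exp (- (116/1000)) + exp (- (116/1000)) * (z - 116/1000))"
      using that exp_bounds
      by (elim disjE; hypsubst) (simp_all add: w1_def w2_def w3_def rates_def field_simps)
  qed (intro tendsto_intros w_lim; simp)+
  show ?thesis
    using above slope upper[OF disjI1[OF refl]] upper[OF disjI2[OF refl]]
      lower[OF disjI1[OF refl]] lower[OF disjI2[OF refl]] eventually_gt_at_top[of 2]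
  proof eventually_elim
    case (elim n)
    show ?case
    proof
      fix p :: real assume p: "p \<in> {0..1}"
      have n: "2 < real n" using elim(7) by simp
      define z where "z = real n * p"
      have "0 \<le> z" using p by (simp add: z_def)
      have p_z: "p = z / real n" using n by (simp add: z_def)
      have min: "min p (t / real n) / (t / real n) = min z t / t" if "0 < t" for t
        using that n unfolding p_z by (auto simp: min_def field_simps)
      have "(\<Sum>l<3. level_prob (\<lambda>l. rates l / real n) n (Suc l) * min p (rates l / real n) / (rates l / real n))
        = (\<Sum>l<3. w (Suc l) n * (min z (rates l) / rates l))"
        by (intro sum.cong refl, simp only: w_def times_divide_eq_right[symmetric], subst min)
          (auto simp: rates_def)
      also have "\<dots> = w 1 n * (min z (2035/1000) / (2035/1000)) + w 2 n * (min z (506/1000) / (506/1000))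
          + w 3 n * (min z (57/1000) / (57/1000))"
        by (simp add: eval_nat_numeral rates_def)
      also have "\<dots> \<ge> 0.869 * (1 - (1 - p) ^ n)"
      proof -
        consider "z \<le> 57/1000" | "57/1000 \<le> z" "z \<le> 506/1000" | "506/1000 \<le> z" "z \<le> 2035/1000" 
          | "2035/1000 \<le> z" by linarith
        then show ?thesis
        proof cases
          case 1
          have "1 - (1 - p) ^ n \<le> z"
            using power_ge_tangent[of "1 - p" 1 n] p by (simp add: z_def)
          moreover have "0.869 * z \<le> (w 1 n / (2035/1000) + w 2 n / (506/1000) + w 3 n / (57/1000)) * z"
            using elim(2) \<open>0 \<le> z\<close> by (intro mult_right_mono) auto
          ultimately show ?thesis using 1 by (simp add: algebra_simps)
        next
          case 2
          \<comment> \<open>The guarantee minus \<open>0.869\<close> times the tangent, written as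
            an affine function of \<open>z\<close>; its values at the two ends are those in
            \<open>lower\<close>. The next case uses \<open>upper\<close> in the same way.\<close>
          have "0 \<le> (w 3 n - 0.869 * (1 - E (116/1000) n - E' (116/1000) n * (116/1000)))
              + (w 1 n / (2035/1000) + w 2 n / (506/1000) - 0.869 * E' (116/1000) n) * z"
            by (rule linear_nonneg[OF _ _ 2]; use elim(5,6) in \<open>simp add: algebra_simps\<close>)
          then show ?thesis 
            using 2 tangent[of p "116/1000" n] p n by (simp add: z_def algebra_simps)
        next
          case 3
          have "0 \<le> (w 2 n + w 3 n - 0.869 * (1 - E (1035/1000) n - E' (1035/1000) n * (1035/1000)))
              + (w 1 n / (2035/1000) - 0.869 * E' (1035/1000) n) * z"
            by (rule linear_nonneg[OF _ _ 3]; use elim(3,4) in \<open>simp add: algebra_simps\<close>)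
          then show ?thesis 
            using 3 tangent[of p "1035/1000" n] p n by (simp add: z_def algebra_simps)
        next
          case 4
          have "0 \<le> (1 - p) ^ n" using p by simp
          then show ?thesis using 4 elim(1) by simp
        qed
      qed
      finally show "0.869 * (1 - (1 - p) ^ n) \<le> (\<Sum>l<3. level_prob (\<lambda>l. rates l / real n) n (Suc l)
        * min p (rates l / real n) / (rates l / real n))" .
    qed
  qed
qed

section \<open>The testing program\<close>

definition threshold :: "real measure \<Rightarrow> nat \<Rightarrow> nat \<Rightarrow> real" where
  "threshold F n l = quantile F (1 - rates l / real n)"

text \<open>From level \<open>3\<close> on \<open>threshold\<close> is \<open>0\<close>, whose
  half-line would accept every nonnegative value; the empty set has the probability
  \<open>rates l / n = 0\<close> instead.\<close>

definition acceptance :: "real measure \<Rightarrow> nat \<Rightarrow> nat \<Rightarrow> real set" where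
  "acceptance F n l = (if l < 3 then {threshold F n l..} else {})"

text \<open>
  At level \<open>3\<close> the rate is \<open>0\<close>, so the threshold is the default \<open>quantile F 1 = 0\<close>; the positive outcome
  of such a test is ignored. Natural addresses: \<open>0\<close> number of boxes, then output; \<open>1\<close> tests done;
  \<open>2\<close> level; \<open>3\<close> candidate; \<open>4\<close> outcome of the last test.
\<close>

definition loop_body :: prog where
  "loop_body =
     Sequence
       (Test (NConst 4)
         (Quantile (RMinus (RConst 1) (RDivide (RLoad (NLoad (NConst 2))) (OfNat (NLoad (NConst 0)))))))
     (Sequence
       (Cond (BAnd (NLess (NConst 0) (NLoad (NConst 4))) (NLess (NLoad (NConst 2)) (NConst 3)))
         (Sequence (NStore (NConst 2) (NPlus (NLoad (NConst 2)) (NConst 1)))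
                   (NStore (NConst 3) (NPlus (NLoad (NConst 1)) (NConst 1))))
         Skip)
       (NStore (NConst 1) (NPlus (NLoad (NConst 1)) (NConst 1))))"

definition loop :: prog where
  "loop = While (NLess (NLoad (NConst 1)) (NLoad (NConst 0))) loop_body"

definition three_level_prog :: prog where
  "three_level_prog =
     Sequence (RStore (NConst 0) (RConst (2035 / 1000)))
     (Sequence (RStore (NConst 1) (RConst (506 / 1000)))
     (Sequence (RStore (NConst 2) (RConst (57 / 1000)))
     (Sequence (NStore (NConst 3) (NConst 1))
     (Sequence loop
       (NStore (NConst 0) (NLoad (NConst 3)))))))"

text \<open>The whole real memory can be equated with \<open>rates\<close>, as it is initially zero;
  so the load at level \<open>3\<close> returns \<open>rates 3 = 0\<close>.\<close>

definition loop_invariant ::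
  "real measure \<Rightarrow> nat \<Rightarrow> (nat \<Rightarrow> real) \<Rightarrow> nat \<Rightarrow> state \<Rightarrow> bool" where
  "loop_invariant F n x i s \<longleftrightarrow>
     nmem s 0 = n \<and> nmem s 1 = i \<and>
     (nmem s 2, nmem s 3) = candidate (acceptance F n) x i \<and>
     rmem s = rates \<and>
     length (thresholds s) = i \<and> (\<forall>t\<in>set (thresholds s). 0 \<le> t)"

text \<open>The run of the loop-free body is computed: \<open>8\<close> steps on acceptance and
  \<open>5\<close> otherwise. Address \<open>1\<close> is raised last, so the box under test is its
  content plus one.\<close>

lemma loop_body_step:
  assumes inv: "loop_invariant F n x i s"
    and pos: "\<And>l. 0 \<le> threshold F n l"
  shows "\<exists>k s'. exec F x u loop_body s k s' \<and> k \<le> 10 \<and> loop_invariant F n x (Suc i) s'"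
proof -
  have cand: "candidate (acceptance F n) x i = (nmem s 2, nmem s 3)"
    using inv by (simp add: loop_invariant_def)
  define t where "t = threshold F n (nmem s 2)"
  have "0 \<le> t" unfolding t_def by (rule pos)
  show ?thesis
  proof (cases "t \<le> x (Suc i) \<and> nmem s 2 < 3")
    case True
    have "\<exists>s'. exec F x u loop_body s 8 s' \<and> loop_invariant F n x (Suc i) s'"
      using inv True cand \<open>0 \<le> t\<close>
      by (auto simp: loop_body_def exec_Suc_iff exec_0_iff numeral_eq_Suc loop_invariant_def
          Let_def threshold_def acceptance_def t_def)
    then show ?thesis by (intro exI[of _ 8]) auto
  next
    case False
    have "\<exists>s'. exec F x u loop_body s 5 s' \<and> loop_invariant F n x (Suc i) s'"
      using inv False cand \<open>0 \<le> t\<close>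
      by (auto simp: loop_body_def exec_Suc_iff exec_0_iff numeral_eq_Suc loop_invariant_def
          Let_def threshold_def acceptance_def t_def)
    then show ?thesis by (intro exI[of _ 5]) auto
  qed
qed

text \<open>A round costs at most \<open>10\<close> steps for the body and \<open>2\<close> for the
  loop; the final \<open>1\<close> is the failing guard.\<close>

lemma exec_loop:
  assumes pos: "\<And>l. 0 \<le> threshold F n l"
    and "i \<le> n" "loop_invariant F n x i s"
  shows "\<exists>k s'. exec F x u loop s k s' \<and> k \<le> 12 * (n - i) + 1 \<and> loop_invariant F n x n s'"
  using assms(2,3)
proof (induction "n - i" arbitrary: i s)
  case 0
  then have "exec F x u loop s 1 s"
    unfolding loop_def by (intro exec_While_False) (simp add: loop_invariant_def)
  then show ?case using 0 by fastforce
next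
  case (Suc m)
  from loop_body_step[OF Suc.prems(2) pos]
  obtain k s1 where 1: "exec F x u loop_body s k s1" "k \<le> 10" "loop_invariant F n x (Suc i) s1"
    by blast
  have "m = n - Suc i" "Suc i \<le> n" using Suc.hyps(2) by auto
  from Suc.hyps(1)[OF this 1(3)]
  obtain k' s' where 2: "exec F x u loop s1 k' s'" "k' \<le> 12 * (n - Suc i) + 1"
      "loop_invariant F n x n s'"
    by blast
  have "exec F x u loop s (k + k' + 2) s'"
    using 1(1) 2(1) Suc.hyps(2) Suc.prems(2) unfolding loop_def
    by (intro exec_While_True) (auto simp: loop_invariant_def)
  moreover have "k + k' + 2 \<le> 12 * (n - i) + 1"
    using 1(2) 2(2) Suc.hyps(2) by linarith
  ultimately show ?case using 2(3) by blast
qed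

lemma exec_three_level_prog:
  assumes pos: "\<And>l. 0 \<le> threshold F n l"
  shows "\<exists>k s. exec F x u three_level_prog (init n) k s \<and> k \<le> 12 * n + 11 \<and>
           nmem s 0 = snd (candidate (acceptance F n) x n) \<and>
           length (thresholds s) = n \<and> (\<forall>t\<in>set (thresholds s). 0 \<le> t)"
proof -
  define s0 where "s0 = \<lparr>nmem = (\<lambda>_. 0)(0 := n, 3 := 1), rmem = rates, draws = 0, thresholds = []\<rparr>"
  have "loop_invariant F n x 0 s0"
    by (simp add: loop_invariant_def s0_def)
  from exec_loop[OF pos le0 this, where u = u]
  obtain k s where 1: "exec F x u loop s0 k s" "k \<le> 12 * n + 1" "loop_invariant F n x n s"
    by auto
  define s' where "s' = s\<lparr>nmem := (nmem s)(0 := nmem s 3)\<rparr>"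
  have "exec F x u (NStore (NConst 0) (NLoad (NConst 3))) s 1 s'"
    by (simp add: exec_Suc_iff exec_0_iff s'_def)
  from exec_Sequence[OF 1(1) this]
  \<comment> \<open>The four initial stores take two steps each, one to execute and one to drop
    \<open>Skip\<close>.\<close>
  have "exec F x u three_level_prog (init n) (8 + (Suc (k + 1))) s'"
    by (simp add: three_level_prog_def exec_Suc_iff numeral_eq_Suc init_def s0_def rates_def of_rat_divide)
  then show ?thesis
    using 1(2,3) by (intro exI[of _ "8 + (Suc (k + 1))"] exI[of _ s'])
      (auto simp: loop_invariant_def s'_def dest: sym)
qed

section \<open>Competitive ratio\<close>

lemma prob_space_randomness_measure: "prob_space randomness_measure"
  unfolding randomness_measure_def
  by (intro prob_space_PiM prob_space_uniform_measure) auto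

text \<open>The program draws no random numbers, so the expected reward is an integral over the
  hidden values alone.\<close>

lemma integral_fst:
  fixes f :: "'a \<Rightarrow> real"
  assumes "prob_space N" "f \<in> borel_measurable M"
  shows "(LINT (x, u)|(M \<Otimes>\<^sub>M N). f x) = (LINT x|M. f x)"
proof -
  have "(LINT x|M. f x) = (LINT x|distr (M \<Otimes>\<^sub>M N) M fst. f x)"
    using prob_space.distr_pair_fst[OF assms(1), of M] by simp
  also have "\<dots> = (LINT z|(M \<Otimes>\<^sub>M N). f (fst z))"
    using assms(2) by (intro integral_distr) auto
  finally show ?thesis by (simp add: split_beta')
qed

lemma threshold_nonneg: "continuous_nonneg_distribution F \<Longrightarrow> 0 \<le> threshold F n l"
  unfolding threshold_def by (rule quantile_nonneg)

lemma chosen_box_three_level_prog: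
  assumes "continuous_nonneg_distribution F"
  shows "chosen_box three_level_prog F n x u = snd (candidate (acceptance F n) x n)"
proof -
  from exec_three_level_prog[OF threshold_nonneg[OF assms], where n = n and x = x and u = u]
  obtain k s where "exec F x u three_level_prog (init n) k s"
    "nmem s 0 = snd (candidate (acceptance F n) x n)"
    by blast
  then show ?thesis
    by (simp add: chosen_box_def exec_halts(3))
qed

lemma testing_algorithm_three_level_prog: "testing_algorithm three_level_prog"
  unfolding testing_algorithm_def
proof (intro allI impI)
  fix F n x u assume adm: "admissible F n x u"
  then have F: "continuous_nonneg_distribution F" and n: "1 \<le> n"
    by (simp_all add: admissible_def)
  from exec_three_level_prog[OF threshold_nonneg[OF F], where n = n and x = x and u = u]
  obtain k s where "exec F x u three_level_prog (init n) k s"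
    "length (thresholds s) = n" "\<forall>t\<in>set (thresholds s). 0 \<le> t"
    by blast
  moreover have "chosen_box three_level_prog F n x u \<in> {1..n}"
    unfolding chosen_box_three_level_prog[OF F]
    using n snd_candidate_ge snd_candidate_le[of "acceptance F n" x n] by simp
  ultimately show "halts three_level_prog F n x u \<and>
      length (thresholds (final_state three_level_prog F n x u)) = n \<and>
      (\<forall>t\<in>set (thresholds (final_state three_level_prog F n x u)). 0 \<le> t) \<and>
      chosen_box three_level_prog F n x u \<in> {1..n}"
    by (simp add: exec_halts)
qed

lemma efficient_three_level_prog: "efficient three_level_prog"
  unfolding efficient_def
proof (intro exI allI impI)
  fix F n x u assume adm: "admissible F n x u"
  then have F: "continuous_nonneg_distribution F" and n: "1 \<le> n"
    by (simp_all add: admissible_def)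
  from exec_three_level_prog[OF threshold_nonneg[OF F], where n = n and x = x and u = u]
  obtain k s where k: "exec F x u three_level_prog (init n) k s" "k \<le> 12 * n + 11"
    by blast
  have "k \<le> 23 * n ^ 1" using k(2) n by simp
  then show "halts three_level_prog F n x u \<and> run_time three_level_prog F n x u \<le> 23 * n ^ 1"
    using exec_halts[OF k(1)] by simp
qed

section \<open>Expected reward for a fixed distribution and number of boxes\<close>

context
  fixes F :: "real measure" and n :: nat
  assumes F: "continuous_nonneg_distribution F" and n: "1 \<le> n"
begin

interpretation real_distribution F
  using F by (simp add: continuous_nonneg_distribution_def)

interpretation candidate_process F "acceptance F n"
  by unfold_locales (simp_all add: acceptance_def)

interpretation P: finite_product_prob_space "\<lambda>_. F" "{1..n}"
  by standard auto

lemma measurable_max: "(\<lambda>x. Max (x ` {1..n})) \<in> borel_measurable (values_measure F n)"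
proof (rule borel_measurable_Max)
  fix i assume "i \<in> {1..n}"
  then have "(\<lambda>x. x i) \<in> values_measure F n \<rightarrow>\<^sub>M F"
    unfolding values_measure_def by (rule measurable_component_singleton)
  then show "(\<lambda>x. x i) \<in> borel_measurable (values_measure F n)"
    by (simp add: measurable_cong_sets[OF refl sets_F])
qed simp

lemma measurable_reward:
  "(\<lambda>x. x (snd (candidate (acceptance F n) x n))) \<in> borel_measurable (values_measure F n)"
  unfolding values_measure_def
  using measurable_candidate_value[where S = "acceptance F n", OF sets_S sets_F order.refl n] .

lemma AE_values_nonneg: "AE x in values_measure F n. \<forall>i\<in>{1..n}. 0 \<le> x i"
  unfolding values_measure_def
  using F by (intro AE_ball_countable[THEN iffD2] ballI AE_PiM_component)
    (auto simp: continuous_nonneg_distribution_def prob_space_axioms)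

lemma snd_candidate_mem: "snd (candidate (acceptance F n) x n) \<in> {1..n}"
  using n snd_candidate_ge snd_candidate_le[of "acceptance F n" x n] by simp

lemma expected_reward_eq:
  "expected_reward three_level_prog F n =
     enn2real (\<integral>\<^sup>+ x. ennreal (x (snd (candidate (acceptance F n) x n))) \<partial>values_measure F n)"
proof -
  have "AE x in values_measure F n. 0 \<le> x (snd (candidate (acceptance F n) x n))"
    using AE_values_nonneg by eventually_elim (rule bspec[OF _ snd_candidate_mem])
  then show ?thesis
    unfolding expected_reward_def chosen_box_three_level_prog[OF F]
    by (simp add: integral_fst[OF prob_space_randomness_measure measurable_reward]
        integral_eq_nn_integral measurable_reward)
qed

lemma expected_maximum_eq:
  "expected_maximum F n = enn2real (\<integral>\<^sup>+ x. ennreal (Max (x ` {1..n})) \<partial>values_measure F n)"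
proof -
  have "AE x in values_measure F n. 0 \<le> Max (x ` {1..n})"
    using AE_values_nonneg by eventually_elim (use n in \<open>auto simp: Max_ge_iff\<close>)
  then show ?thesis
    unfolding expected_maximum_def by (intro integral_eq_nn_integral measurable_max)
qed

text \<open>Finiteness is what makes \<open>enn2real\<close> monotone here, since it sends infinity
  to \<open>0\<close>. The sum of all absolute values dominates the reward.\<close>

lemma nn_integral_reward_finite:
  "(\<integral>\<^sup>+ x. ennreal (x (snd (candidate (acceptance F n) x n))) \<partial>values_measure F n) < \<infinity>"
proof -
  have int: "integrable (values_measure F n) (\<lambda>x. x i)" if "i \<in> {1..n}" for i
  proof -
    have "integrable (distr (values_measure F n) F (\<lambda>x. x i)) (\<lambda>y. y)"
      unfolding values_measure_def P.PiM_component[OF that]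
      using F by (simp add: continuous_nonneg_distribution_def)
    then show ?thesis
      by (rule integrable_distr[rotated]) (use that in \<open>simp add: values_measure_def\<close>)
  qed
  then have "integrable (values_measure F n) (\<lambda>x. \<Sum>i\<in>{1..n}. \<bar>x i\<bar>)"
    by auto
  then have "(\<integral>\<^sup>+ x. ennreal (norm (\<Sum>i\<in>{1..n}. \<bar>x i\<bar>)) \<partial>values_measure F n) < \<infinity>"
    by (simp add: integrable_iff_bounded)
  moreover have "x (snd (candidate (acceptance F n) x n)) \<le> norm (\<Sum>i\<in>{1..n}. \<bar>x i\<bar>)" for x
  proof -
    have "\<bar>x (snd (candidate (acceptance F n) x n))\<bar> \<le> (\<Sum>i\<in>{1..n}. \<bar>x i\<bar>)"
      by (rule member_le_sum[OF snd_candidate_mem]) auto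
    then show ?thesis by simp
  qed
  then have "(\<integral>\<^sup>+ x. ennreal (x (snd (candidate (acceptance F n) x n))) \<partial>values_measure F n) \<le>
      (\<integral>\<^sup>+ x. ennreal (norm (\<Sum>i\<in>{1..n}. \<bar>x i\<bar>)) \<partial>values_measure F n)"
    by (intro nn_integral_mono ennreal_leI)
  ultimately show ?thesis by (rule order.strict_trans1[rotated])
qed

text \<open>The largest rate is \<open>2.035\<close>, so \<open>3 \<le> n\<close> keeps
  \<open>rates l / n\<close> a probability.\<close>

lemma prob_acceptance:
  assumes "3 \<le> n"
  shows "prob (acceptance F n l) = rates l / real n"
proof (cases "l < 3")
  case True
  then have "0 < rates l" "rates l \<le> 3" by (auto simp: rates_def)
  then have "0 < rates l / real n" "rates l / real n \<le> 1"
    using assms by simp_all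
  from prob_atLeast_quantile[OF F this] True show ?thesis
    by (simp add: acceptance_def threshold_def)
next
  case False
  then show ?thesis by (simp add: acceptance_def rates_def)
qed

text \<open>The tails of reward and maximum at each \<open>t\<close> depend on \<open>F\<close> only
  through \<open>p = prob {t..}\<close> in the bounds used, so \<open>level_bounds\<close> compares
  them; the layer-cake formula integrates the comparison over \<open>t > 0\<close>.\<close>

lemma reward_ge_maximum:
  assumes "3 \<le> n"
    and level_bounds: "\<forall>p\<in>{0..1}. 0.869 * (1 - (1 - p) ^ n) \<le>
       (\<Sum>l<3. level_prob (\<lambda>l. rates l / real n) n (Suc l) * min p (rates l / real n) / (rates l / real n))"
  shows "expected_reward three_level_prog F n \<ge> 0.869 * expected_maximum F n"
proof -
  let ?V = "values_measure F n"
  interpret V: prob_space ?V unfolding values_measure_def by (rule P.prob_space_axioms)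
  have tail: "ennreal 0.869 * emeasure ?V {x \<in> space ?V. t \<le> Max (x ` {1..n})} \<le>
      emeasure ?V {x \<in> space ?V. t \<le> x (snd (candidate (acceptance F n) x n))}" for t
  proof -
    have "0.869 * V.prob {x \<in> space ?V. t \<le> Max (x ` {1..n})} = 0.869 * (1 - (1 - prob {t..}) ^ n)"
      unfolding values_measure_def measure_max_ge[OF F n] ..
    also have "\<dots> \<le> (\<Sum>l<3. level_prob (\<lambda>l. rates l / real n) n (Suc l) * 
        min (prob {t..}) (rates l / real n) / (rates l / real n))"
      using level_bounds by simp
    also have "\<dots> = (\<Sum>l<3. level_mass n (Suc l) {t..})"
    proof (intro sum.cong refl)
      fix l :: nat assume "l \<in> {..<3}"
      then have l: "l < 3" "rates l \<noteq> 0" by (auto simp: rates_def)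
      \<comment> \<open>Both sets are upper half-lines, hence nested; this produces the minimum in
        the guarantee.\<close>
      have "prob (acceptance F n l \<inter> {t..}) = min (rates l / real n) (prob {t..})"
        using l prob_atLeast_Int[OF F] prob_acceptance[OF assms(1), of l] by (simp add: acceptance_def)
      then show "level_prob (\<lambda>l. rates l / real n) n (Suc l) * 
          min (prob {t..}) (rates l / real n) / (rates l / real n) = level_mass n (Suc l) {t..}"
        using l n by (simp add: level_mass_eq prob_acceptance[OF assms(1)] min.commute)
    qed
    also have "\<dots> \<le> V.prob {x \<in> space ?V. x (snd (candidate (acceptance F n) x n)) \<in> {t..}}"
      unfolding values_measure_def by (rule sum_level_mass_le) (use n in auto)
    finally show ?thesis
      by (simp add: V.emeasure_eq_measure flip: ennreal_mult)
  qed
  have "ennreal 0.869 * (\<integral>\<^sup>+ x. ennreal (Max (x ` {1..n})) \<partial>?V) =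
      (\<integral>\<^sup>+ t. ennreal 0.869 * (emeasure ?V {x \<in> space ?V. t \<le> Max (x ` {1..n})} * indicator {0<..} t) \<partial>lborel)"
    unfolding nn_integral_layer_cake[OF V.sigma_finite_measure_axioms measurable_max]
    by (rule nn_integral_cmult[symmetric])
      (use measurable_upper_tail[OF V.sigma_finite_measure_axioms measurable_max] in measurable)
  also have "\<dots> \<le> (\<integral>\<^sup>+ x. ennreal (x (snd (candidate (acceptance F n) x n))) \<partial>?V)"
    unfolding nn_integral_layer_cake[OF V.sigma_finite_measure_axioms measurable_reward]
    by (intro nn_integral_mono) (use tail in \<open>simp add: mult.assoc[symmetric] mult_right_mono\<close>)
  finally have "enn2real (ennreal 0.869 * (\<integral>\<^sup>+ x. ennreal (Max (x ` {1..n})) \<partial>?V)) \<le> expected_reward three_level_prog F n"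
    unfolding expected_reward_eq using nn_integral_reward_finite by (intro enn2real_mono) auto
  then show ?thesis
    by (simp add: enn2real_mult expected_maximum_eq)
qed

end

theorem theorem4:
  "\<exists>P. testing_algorithm P \<and> efficient P \<and>
     (\<exists>\<epsilon> :: nat \<Rightarrow> real. \<epsilon> \<longlonglongrightarrow> 0 \<and>
        (\<forall>F n. continuous_nonneg_distribution F \<longrightarrow> 1 \<le> n \<longrightarrow>
           expected_reward P F n \<ge> (0.869 - \<epsilon> n) * expected_maximum F n))"
proof -
  obtain N where N: "\<And>n. N \<le> n \<Longrightarrow> \<forall>p\<in>{0..1}. 0.869 * (1 - (1 - p) ^ n) \<le>
       (\<Sum>l<3. level_prob (\<lambda>l. rates l / real n) n (Suc l) * min p (rates l / real n) / (rates l / real n))"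
    using eventually_level_bounds unfolding eventually_sequentially by blast
  \<comment> \<open>For small \<open>n\<close> the error \<open>0.869\<close> reduces the claim to
    nonnegativity of the reward, which \<open>expected_reward_eq\<close> shows through
    \<open>enn2real\<close>; from \<open>max 3 N\<close> on the error is \<open>0\<close>.\<close>
  define \<epsilon> :: "nat \<Rightarrow> real" where "\<epsilon> n = (if n < max 3 N then 0.869 else 0)" for n
  have "\<forall>\<^sub>F n in sequentially. \<epsilon> n = 0"
    using eventually_ge_at_top[of "max 3 N"] by eventually_elim (auto simp: \<epsilon>_def)
  then have lim: "\<epsilon> \<longlonglongrightarrow> 0" by (rule tendsto_eventually)
  moreover have "expected_reward three_level_prog F n \<ge> (0.869 - \<epsilon> n) * expected_maximum F n"
    if "continuous_nonneg_distribution F" "1 \<le> n" for F n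
    using reward_ge_maximum[OF that] N[of n] expected_reward_eq[OF that] by (auto simp: \<epsilon>_def)
  ultimately show ?thesis
    using testing_algorithm_three_level_prog efficient_three_level_prog by blast
qed

end
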